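(* Let $G$ and $H$ be groups, let $\phi : H \to G$ be a group homomorphism, and let $V$ be a vector space over a field $\mathbb{K}$. Let $\tau : V^G \to V^H$ be a $\phi$-equivariant and $\mathbb{K}$-linear map. Then the following conditions are equivalent: (a) $\tau$ is a linear $\phi$-cellular automaton; (b) $\tau$ is uniformly continuous with respect to the prodiscrete uniform structures on $V^G$ and $V^H$; (c) $\tau$ is continuous with respect to the prodiscrete topologies on $V^G$ and $V^H$; (d) $\tau$ is continuous, with respect to the prodiscrete topologies on $V^G$ and $V^H$, at the constant configuration $x = 0$.
   Context: For a group $G$ and a set $A$, $A^G$ is the set of all maps $x : G \to A$. The group $G$ acts on $A^G$ on the left by $(g\cdot x)(g') = x(g^{-1}g')$; similarly $H$ acts on $A^H$. When $A = V$ is a vector space over $\mathbb{K}$, $V^G$ and $V^H$ are $\mathbb{K}$-vector spaces with pointwise operations. For a group homomorphism $\phi : H \to G$, a $\phi$-cellular automaton from $A^G$ to $A^H$ is a map $\tau : A^G \to A^H$ for which there exist a finite subset $S \subseteq G$ (a memory set) and a map $\mu : A^S \to A$ (a local function) such that $\tau(x)(h) = \mu\big((\phi(h^{-1})\cdot x)|_S\big)$ for all $x \in A^G$ and $h \in H$. A linear $\phi$-cellular automaton is a $\phi$-cellular automaton $\tau : V^G \to V^H$ that is $\mathbb{K}$-linear. A map $\tau : A^G \to A^H$ is $\phi$-equivariant if $\tau(\phi(h)\cdot x) = h\cdot\tau(x)$ for all $h \in H$, $x \in A^G$. The prodiscrete topology on $A^G$ is the product topology with each factor $A$ discrete. The prodiscrete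 uniform structure on $A^G$ is the product uniform structure with each factor $A$ having the discrete uniform structure; a base of entourages is given by $W_\Omega = \{(x,y) \in A^G\times A^G : x|_\Omega = y|_\Omega\}$ for $\Omega$ a finite subset of $G$. The same definitions apply to $A^H$. *)

theory Defs
  imports "HOL-Analysis.Analysis" "Jordan_Normal_Form.Missing_VectorSpace"
begin

text \<open>
  Groups, fields and vector spaces are the carrier-based structures of HOL-Algebra.
  A configuration over a set \<open>I\<close> with values in \<open>A\<close> is therefore an extensional
  function, i.e. an element of \<open>I \<rightarrow>\<^sub>E A\<close>.
\<close>

definition shift :: "('g, 'm) monoid_scheme \<Rightarrow> 'g \<Rightarrow> ('g \<Rightarrow> 'a) \<Rightarrow> ('g \<Rightarrow> 'a)"
  where "shift G g x = (\<lambda>g'\<in>carrier G. x (inv\<^bsub>G\<^esub> g \<otimes>\<^bsub>G\<^esub> g'))"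

definition cellular_automaton ::
  "('g, 'm) monoid_scheme \<Rightarrow> ('h, 'n) monoid_scheme \<Rightarrow> ('h \<Rightarrow> 'g) \<Rightarrow> 'a set
    \<Rightarrow> (('g \<Rightarrow> 'a) \<Rightarrow> ('h \<Rightarrow> 'a)) \<Rightarrow> bool"
  where "cellular_automaton G H \<phi> A \<tau> \<longleftrightarrow>
    \<tau> \<in> (carrier G \<rightarrow>\<^sub>E A) \<rightarrow> (carrier H \<rightarrow>\<^sub>E A) \<and>
    (\<exists>S \<mu>. finite S \<and> S \<subseteq> carrier G \<and> \<mu> \<in> (S \<rightarrow>\<^sub>E A) \<rightarrow> A \<and>
      (\<forall>x \<in> carrier G \<rightarrow>\<^sub>E A. \<forall>h \<in> carrier H.
         \<tau> x h = \<mu> (restrict (shift G (\<phi> (inv\<^bsub>H\<^esub> h)) x) S)))"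

definition equivariant ::
  "('g, 'm) monoid_scheme \<Rightarrow> ('h, 'n) monoid_scheme \<Rightarrow> ('h \<Rightarrow> 'g) \<Rightarrow> 'a set
    \<Rightarrow> (('g \<Rightarrow> 'a) \<Rightarrow> ('h \<Rightarrow> 'a)) \<Rightarrow> bool"
  where "equivariant G H \<phi> A \<tau> \<longleftrightarrow>
    (\<forall>h \<in> carrier H. \<forall>x \<in> carrier G \<rightarrow>\<^sub>E A. \<tau> (shift G (\<phi> h) x) = shift H h (\<tau> x))"

text \<open>
  The vector space of all configurations over \<open>I\<close> with values in \<open>V\<close>. The module record
  extends the ring record, so the fields \<open>mult\<close> and \<open>one\<close> have to be filled in; they
  play no role for modules.
\<close>

definition power_module :: "'i set \<Rightarrow> ('k, 'v, 'n) module_scheme \<Rightarrow> ('k, 'i \<Rightarrow> 'v) module"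
  where "power_module I V = \<lparr>carrier = I \<rightarrow>\<^sub>E carrier V,
    mult = (\<lambda>x y. \<lambda>i\<in>I. \<zero>\<^bsub>V\<^esub>),
    one = (\<lambda>i\<in>I. \<zero>\<^bsub>V\<^esub>),
    zero = (\<lambda>i\<in>I. \<zero>\<^bsub>V\<^esub>),
    add = (\<lambda>x y. \<lambda>i\<in>I. x i \<oplus>\<^bsub>V\<^esub> y i),
    smult = (\<lambda>c x. \<lambda>i\<in>I. c \<odot>\<^bsub>V\<^esub> x i)\<rparr>"

lemma power_module_simps [simp]:
  "carrier (power_module I V) = (I \<rightarrow>\<^sub>E carrier V)"
  "\<zero>\<^bsub>power_module I V\<^esub> = (\<lambda>i\<in>I. \<zero>\<^bsub>V\<^esub>)"
  "x \<oplus>\<^bsub>power_module I V\<^esub> y = (\<lambda>i\<in>I. x i \<oplus>\<^bsub>V\<^esub> y i)"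
  "c \<odot>\<^bsub>power_module I V\<^esub> x = (\<lambda>i\<in>I. c \<odot>\<^bsub>V\<^esub> x i)"
  by (simp_all add: power_module_def)

lemma vectorspace_power_module:
  assumes "vectorspace K V"
  shows "vectorspace K (power_module I V)"
proof -
  interpret V: vectorspace K V by fact
  have "abelian_group (power_module I V)"
  proof (rule abelian_groupI)
    fix x assume x: "x \<in> carrier (power_module I V)"
    then show "\<exists>y\<in>carrier (power_module I V).
        y \<oplus>\<^bsub>power_module I V\<^esub> x = \<zero>\<^bsub>power_module I V\<^esub>"
      by (intro bexI[of _ "\<lambda>i\<in>I. \<ominus>\<^bsub>V\<^esub> x i"])
         (auto simp: fun_eq_iff PiE_iff V.M.l_neg)
  qed (auto simp: fun_eq_iff PiE_iff extensional_def V.M.a_ac)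
  then have "Module.module K (power_module I V)"
    by (intro moduleI V.R.cring_axioms)
       (auto simp: fun_eq_iff PiE_iff extensional_def V.smult_l_distr V.smult_r_distr V.smult_assoc1)
  then show ?thesis
    by (simp add: vectorspace_def V.field_axioms)
qed

definition linear_cellular_automaton ::
  "('g, 'm) monoid_scheme \<Rightarrow> ('h, 'n) monoid_scheme \<Rightarrow> ('h \<Rightarrow> 'g)
    \<Rightarrow> ('k, 'p) ring_scheme \<Rightarrow> ('k, 'v, 'q) module_scheme
    \<Rightarrow> (('g \<Rightarrow> 'v) \<Rightarrow> ('h \<Rightarrow> 'v)) \<Rightarrow> bool"
  where "linear_cellular_automaton G H \<phi> K V \<tau> \<longleftrightarrow>
    cellular_automaton G H \<phi> (carrier V) \<tau> \<and>
    \<tau> \<in> module_hom K (power_module (carrier G) V) (power_module (carrier H) V)"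

definition prodiscrete_topology :: "'i set \<Rightarrow> 'a set \<Rightarrow> ('i \<Rightarrow> 'a) topology"
  where "prodiscrete_topology I A = product_topology (\<lambda>_. discrete_topology A) I"

text \<open>
  Uniform structures on a set \<open>X\<close> are represented, as in the library's type class
  \<open>uniform_space\<close>, by the filter of their entourages, but living on \<open>X \<times> X\<close> instead of
  the whole type. The discrete uniform structure on \<open>A\<close> consists of all supersets of the
  diagonal of \<open>A\<close>; the product structure is the coarsest one that makes all
  projections uniformly continuous.
\<close>

definition prodiscrete_uniformity :: "'i set \<Rightarrow> 'a set \<Rightarrow> (('i \<Rightarrow> 'a) \<times> ('i \<Rightarrow> 'a)) filter"
  where "prodiscrete_uniformity I A =
    inf (INF i\<in>I. filtercomap (\<lambda>(x, y). (x i, y i)) (principal (Id_on A)))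
        (principal ((I \<rightarrow>\<^sub>E A) \<times> (I \<rightarrow>\<^sub>E A)))"

definition uniformly_continuous_wrt ::
  "('a \<times> 'a) filter \<Rightarrow> ('b \<times> 'b) filter \<Rightarrow> ('a \<Rightarrow> 'b) \<Rightarrow> bool"
  where "uniformly_continuous_wrt U U' f \<longleftrightarrow> filterlim (\<lambda>(x, y). (f x, f y)) U' U"

text \<open>
  The sets of pairs of configurations that agree on a finite set \<open>\<Omega>\<close> form a base of entourages.
\<close>

lemma eventually_prodiscrete_uniformity:
  "eventually P (prodiscrete_uniformity I A) \<longleftrightarrow>
    (\<exists>\<Omega>. finite \<Omega> \<and> \<Omega> \<subseteq> I \<and>
      (\<forall>x \<in> I \<rightarrow>\<^sub>E A. \<forall>y \<in> I \<rightarrow>\<^sub>E A. restrict x \<Omega> = restrict y \<Omega> \<longrightarrow> P (x, y)))"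
proof -
  let ?W = "\<lambda>\<Omega>. {(x, y). \<forall>i\<in>\<Omega>. (x i, y i) \<in> Id_on A}"
  have fin: "(INF i\<in>\<Omega>. filtercomap (\<lambda>(x, y). (x i, y i)) (principal (Id_on A))) = principal (?W \<Omega>)"
    if "finite \<Omega>" for \<Omega> :: "'i set"
  proof -
    have "(INF i\<in>\<Omega>. filtercomap (\<lambda>(x, y). (x i, y i)) (principal (Id_on A)))
        = (INF i\<in>\<Omega>. principal ((\<lambda>(x, y). (x i, y i)) -` Id_on A))"
      by (simp only: filtercomap_principal)
    also have "\<dots> = principal (\<Inter>i\<in>\<Omega>. (\<lambda>(x, y). (x i, y i)) -` Id_on A)"
      using that by (rule INF_principal_finite)
    also have "(\<Inter>i\<in>\<Omega>. (\<lambda>(x, y). (x i, y i)) -` Id_on A) = ?W \<Omega>"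
      by auto
    finally show ?thesis .
  qed
  have agree: "(\<forall>p. p \<in> ?W \<Omega> \<longrightarrow> p \<in> (I \<rightarrow>\<^sub>E A) \<times> (I \<rightarrow>\<^sub>E A) \<longrightarrow> P p) \<longleftrightarrow>
      (\<forall>x \<in> I \<rightarrow>\<^sub>E A. \<forall>y \<in> I \<rightarrow>\<^sub>E A. restrict x \<Omega> = restrict y \<Omega> \<longrightarrow> P (x, y))"
    if "\<Omega> \<subseteq> I" for \<Omega>
  proof -
    have W: "(x, y) \<in> ?W \<Omega> \<longleftrightarrow> restrict x \<Omega> = restrict y \<Omega>"
      if xy: "x \<in> I \<rightarrow>\<^sub>E A" "y \<in> I \<rightarrow>\<^sub>E A" for x y
    proof -
      have "restrict x \<Omega> = restrict y \<Omega> \<longleftrightarrow> (\<forall>i\<in>\<Omega>. x i = y i)"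
        unfolding fun_eq_iff restrict_def by metis
      moreover have "x i \<in> A" if "i \<in> \<Omega>" for i
        using that \<open>\<Omega> \<subseteq> I\<close> xy PiE_mem by fast
      ultimately show ?thesis
        by (simp add: Id_on_iff)
    qed
    show ?thesis
    proof (intro iffI ballI allI impI)
      fix x y
      assume "\<forall>p. p \<in> ?W \<Omega> \<longrightarrow> p \<in> (I \<rightarrow>\<^sub>E A) \<times> (I \<rightarrow>\<^sub>E A) \<longrightarrow> P p"
        and "x \<in> I \<rightarrow>\<^sub>E A" "y \<in> I \<rightarrow>\<^sub>E A" "restrict x \<Omega> = restrict y \<Omega>"
      with W[of x y] show "P (x, y)"
        by (simp only: mem_Sigma_iff)
    next
      fix p
      assume *: "\<forall>x \<in> I \<rightarrow>\<^sub>E A. \<forall>y \<in> I \<rightarrow>\<^sub>E A. restrict x \<Omega> = restrict y \<Omega> \<longrightarrow> P (x, y)"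
        and p: "p \<in> ?W \<Omega>" "p \<in> (I \<rightarrow>\<^sub>E A) \<times> (I \<rightarrow>\<^sub>E A)"
      obtain x y where xy: "p = (x, y)"
        by (rule prod.exhaust)
      have x: "x \<in> I \<rightarrow>\<^sub>E A" and y: "y \<in> I \<rightarrow>\<^sub>E A"
        using p(2) unfolding xy mem_Sigma_iff by simp_all
      have "restrict x \<Omega> = restrict y \<Omega>"
        using p(1) unfolding xy W[OF x y] .
      then show "P p"
        unfolding xy by (rule *[rule_format, OF x y])
    qed
  qed
  have "eventually P (prodiscrete_uniformity I A) \<longleftrightarrow>
      (\<exists>\<Omega>\<subseteq>I. finite \<Omega> \<and>
        (\<forall>p. p \<in> ?W \<Omega> \<longrightarrow> p \<in> (I \<rightarrow>\<^sub>E A) \<times> (I \<rightarrow>\<^sub>E A) \<longrightarrow> P p))"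
    unfolding prodiscrete_uniformity_def eventually_inf_principal
    by (subst eventually_INF, intro ex_cong1 conj_cong refl)
       (simp only: fin eventually_principal Ball_def)
  also have "\<dots> \<longleftrightarrow> (\<exists>\<Omega>. finite \<Omega> \<and> \<Omega> \<subseteq> I \<and>
      (\<forall>x \<in> I \<rightarrow>\<^sub>E A. \<forall>y \<in> I \<rightarrow>\<^sub>E A. restrict x \<Omega> = restrict y \<Omega> \<longrightarrow> P (x, y)))"
    by (simp only: agree conj_ac cong: conj_cong)
  finally show ?thesis .
qed

end

theory Submission
  imports Defs
begin

text \<open>
  Continuity at \<open>0\<close> provides a finite set \<open>S\<close> such that \<open>\<tau> x\<close> vanishes at the identity whenever
  \<open>x\<close> vanishes on \<open>S\<close>. By additivity the value of \<open>\<tau> x\<close> at the identity depends only on \<open>x\<close>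
  restricted to \<open>S\<close>, and by equivariance this one dependence determines \<open>\<tau> x\<close> everywhere, so
  that \<open>S\<close> is a memory set. Conversely, the values of a cellular automaton on \<open>\<Omega>\<close> depend only on
  the restriction of \<open>x\<close> to the finite set \<open>\<phi> \<Omega> S\<close>.
\<close>

section \<open>Open sets of the prodiscrete topology\<close>

lemma topspace_prodiscrete_topology [simp]: "topspace (prodiscrete_topology I A) = (I \<rightarrow>\<^sub>E A)"
  by (simp add: prodiscrete_topology_def)

text \<open>Finite windows suffice because a basic open box restricts only finitely many
  coordinates. Conversely, discreteness makes fixing finitely many coordinates an open condition.
  This puts open sets in the same language of agreement on \<open>\<Omega>\<close> as the
  entourages.\<close>

lemma openin_prodiscrete_topology:
  "openin (prodiscrete_topology I A) U \<longleftrightarrow>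
    U \<subseteq> (I \<rightarrow>\<^sub>E A) \<and>
    (\<forall>x\<in>U. \<exists>\<Omega>. finite \<Omega> \<and> \<Omega> \<subseteq> I \<and>
      (\<forall>y \<in> I \<rightarrow>\<^sub>E A. restrict x \<Omega> = restrict y \<Omega> \<longrightarrow> y \<in> U))"
  (is "?L \<longleftrightarrow> ?R")
proof
  assume L: ?L
  show ?R
  proof (intro conjI ballI)
    show "U \<subseteq> (I \<rightarrow>\<^sub>E A)"
      using openin_subset[OF L] by simp
  next
    fix x assume "x \<in> U"
    then obtain B where fin: "finite {i \<in> I. B i \<noteq> A}" and xB: "x \<in> (\<Pi>\<^sub>E i\<in>I. B i)"
      and BU: "(\<Pi>\<^sub>E i\<in>I. B i) \<subseteq> U"
      using L unfolding prodiscrete_topology_def openin_product_topology_alt topspace_discrete_topology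
      by blast
    \<comment> \<open>The window consists of the indices where the box has a factor other than
      \<open>A\<close>; at every other index, membership in the box is automatic.\<close>
    have "y \<in> U" if y: "y \<in> I \<rightarrow>\<^sub>E A"
      and eq: "restrict x {i \<in> I. B i \<noteq> A} = restrict y {i \<in> I. B i \<noteq> A}" for y
    proof -
      have "y i \<in> B i" if i: "i \<in> I" for i
      proof (cases "B i = A")
        case True
        then show ?thesis using y i by auto
      next
        case False
        then have "x i = y i" using fun_cong[OF eq, of i] i by simp
        then show ?thesis using xB i by (metis PiE_mem)
      qed
      then show ?thesis using y BU by (meson PiE_iff subsetD)
    qed
    then show "\<exists>\<Omega>. finite \<Omega> \<and> \<Omega> \<subseteq> I \<and>
        (\<forall>y \<in> I \<rightarrow>\<^sub>E A. restrict x \<Omega> = restrict y \<Omega> \<longrightarrow> y \<in> U)"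
      using fin by (intro exI[of _ "{i \<in> I. B i \<noteq> A}"]) auto
  qed
next
  assume R: ?R
  show ?L
    unfolding prodiscrete_topology_def openin_product_topology_alt
  proof (intro ballI)
    fix x assume x: "x \<in> U"
    then obtain \<Omega> where fin: "finite \<Omega>" and sub: "\<Omega> \<subseteq> I"
      and \<Omega>: "\<forall>y \<in> I \<rightarrow>\<^sub>E A. restrict x \<Omega> = restrict y \<Omega> \<longrightarrow> y \<in> U"
      using R by blast
    have xA: "x \<in> I \<rightarrow>\<^sub>E A" using R x by blast
    \<comment> \<open>This box is the cylinder of all configurations that agree with
      \<open>x\<close> on \<open>\<Omega>\<close>.\<close>
    define B where "B = (\<lambda>i. if i \<in> \<Omega> then {x i} else A)"
    have "finite {i \<in> I. B i \<noteq> A}"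
      by (rule finite_subset[OF _ fin]) (auto simp: B_def)
    moreover have BA: "B i \<subseteq> A" if "i \<in> I" for i
      using xA that by (auto simp: B_def)
    moreover have "x \<in> (\<Pi>\<^sub>E i\<in>I. B i)"
      using xA by (auto simp: B_def PiE_iff)
    moreover have "(\<Pi>\<^sub>E i\<in>I. B i) \<subseteq> U"
    proof
      fix y assume y: "y \<in> (\<Pi>\<^sub>E i\<in>I. B i)"
      then have "y \<in> I \<rightarrow>\<^sub>E A" using BA by (auto simp: PiE_iff)
      moreover have "y i = x i" if "i \<in> \<Omega>" for i
      proof -
        have "y i \<in> B i" using y sub that by auto
        then show ?thesis using that by (simp add: B_def)
      qed
      then have "restrict x \<Omega> = restrict y \<Omega>" by (auto simp: restrict_def)
      ultimately show "y \<in> U" using \<Omega> by blast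
    qed
    ultimately show "\<exists>B. finite {i \<in> I. B i \<noteq> topspace (discrete_topology A)} \<and>
        (\<forall>i\<in>I. openin (discrete_topology A) (B i)) \<and> x \<in> Pi\<^sub>E I B \<and> Pi\<^sub>E I B \<subseteq> U"
      by (intro exI[of _ B]) auto
  qed
qed

section \<open>Uniform continuity through finite windows\<close>

text \<open>Agreement on a finite set is an entourage, and every entourage contains one of this form
  on pairs of configurations. Hence it is enough to test the filter condition on these basic
  entourages.\<close>

lemma uniformly_continuous_wrt_prodiscrete:
  assumes "f \<in> (I \<rightarrow>\<^sub>E A) \<rightarrow> (J \<rightarrow>\<^sub>E B)"
  shows "uniformly_continuous_wrt (prodiscrete_uniformity I A) (prodiscrete_uniformity J B) f \<longleftrightarrow>
    (\<forall>\<Omega>. finite \<Omega> \<longrightarrow> \<Omega> \<subseteq> J \<longrightarrow> (\<exists>\<Omega>'. finite \<Omega>' \<and> \<Omega>' \<subseteq> I \<and>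
      (\<forall>x \<in> I \<rightarrow>\<^sub>E A. \<forall>y \<in> I \<rightarrow>\<^sub>E A. restrict x \<Omega>' = restrict y \<Omega>' \<longrightarrow>
        restrict (f x) \<Omega> = restrict (f y) \<Omega>)))"
  (is "?L \<longleftrightarrow> ?R")
proof
  assume L: ?L
  show ?R
  proof (intro allI impI)
    fix \<Omega> assume "finite \<Omega>" "\<Omega> \<subseteq> J"
    then have "eventually (\<lambda>(u, v). restrict u \<Omega> = restrict v \<Omega>) (prodiscrete_uniformity J B)"
      unfolding eventually_prodiscrete_uniformity by (intro exI[of _ \<Omega>]) auto
    then have "eventually (\<lambda>p. case (case p of (x, y) \<Rightarrow> (f x, f y)) of
        (u, v) \<Rightarrow> restrict u \<Omega> = restrict v \<Omega>) (prodiscrete_uniformity I A)"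
      using L unfolding uniformly_continuous_wrt_def filterlim_iff by blast
    then show "\<exists>\<Omega>'. finite \<Omega>' \<and> \<Omega>' \<subseteq> I \<and>
      (\<forall>x \<in> I \<rightarrow>\<^sub>E A. \<forall>y \<in> I \<rightarrow>\<^sub>E A. restrict x \<Omega>' = restrict y \<Omega>' \<longrightarrow>
        restrict (f x) \<Omega> = restrict (f y) \<Omega>)"
      unfolding eventually_prodiscrete_uniformity by simp
  qed
next
  assume R: ?R
  show ?L
    unfolding uniformly_continuous_wrt_def filterlim_iff
  proof (intro allI impI)
    fix P assume "eventually P (prodiscrete_uniformity J B)"
    then obtain \<Omega> where \<Omega>: "finite \<Omega>" "\<Omega> \<subseteq> J"
      and P: "\<forall>u \<in> J \<rightarrow>\<^sub>E B. \<forall>v \<in> J \<rightarrow>\<^sub>E B. restrict u \<Omega> = restrict v \<Omega> \<longrightarrow> P (u, v)"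
      unfolding eventually_prodiscrete_uniformity by blast
    obtain \<Omega>' where \<Omega>': "finite \<Omega>'" "\<Omega>' \<subseteq> I"
      and eq: "\<forall>x \<in> I \<rightarrow>\<^sub>E A. \<forall>y \<in> I \<rightarrow>\<^sub>E A. restrict x \<Omega>' = restrict y \<Omega>' \<longrightarrow>
        restrict (f x) \<Omega> = restrict (f y) \<Omega>"
      using R[THEN spec, THEN mp, THEN mp, OF \<Omega>] by (elim exE conjE) (rule that)
    have "P (f x, f y)"
      if x: "x \<in> I \<rightarrow>\<^sub>E A" and y: "y \<in> I \<rightarrow>\<^sub>E A" and "restrict x \<Omega>' = restrict y \<Omega>'" for x y
      using P[THEN bspec, THEN bspec, THEN mp, OF funcset_mem[OF assms x] funcset_mem[OF assms y]
          eq[THEN bspec, THEN bspec, THEN mp, OF that]] .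
    then show "eventually (\<lambda>p. P (case p of (x, y) \<Rightarrow> (f x, f y))) (prodiscrete_uniformity I A)"
      unfolding eventually_prodiscrete_uniformity prod.case
      by (intro exI[of _ \<Omega>'] conjI ballI impI \<Omega>')
  qed
qed

text \<open>A window around \<open>f x\<close> inside \<open>U\<close> pulls back to a window
  \<open>\<Omega>'\<close> valid for all pairs; fixing \<open>x\<close> as one member of the pair
  gives a neighbourhood of \<open>x\<close> inside the preimage of \<open>U\<close>.\<close>

lemma uniformly_continuous_imp_continuous_prodiscrete:
  assumes f: "f \<in> (I \<rightarrow>\<^sub>E A) \<rightarrow> (J \<rightarrow>\<^sub>E B)"
    and uc: "uniformly_continuous_wrt (prodiscrete_uniformity I A) (prodiscrete_uniformity J B) f"
  shows "continuous_map (prodiscrete_topology I A) (prodiscrete_topology J B) f"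
  unfolding continuous_map_def
proof (intro conjI allI impI)
  show "f \<in> topspace (prodiscrete_topology I A) \<rightarrow> topspace (prodiscrete_topology J B)"
    using f by simp
next
  fix U assume U: "openin (prodiscrete_topology J B) U"
  have "\<exists>\<Omega>'. finite \<Omega>' \<and> \<Omega>' \<subseteq> I \<and> (\<forall>y \<in> I \<rightarrow>\<^sub>E A. restrict x \<Omega>' = restrict y \<Omega>' \<longrightarrow> f y \<in> U)"
    if x: "x \<in> I \<rightarrow>\<^sub>E A" "f x \<in> U" for x
  proof -
    obtain \<Omega> where \<Omega>: "finite \<Omega>" "\<Omega> \<subseteq> J"
      "\<forall>v \<in> J \<rightarrow>\<^sub>E B. restrict (f x) \<Omega> = restrict v \<Omega> \<longrightarrow> v \<in> U"
      using U x(2) unfolding openin_prodiscrete_topology by blast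
    obtain \<Omega>' where \<Omega>': "finite \<Omega>'" "\<Omega>' \<subseteq> I"
      and eq: "\<forall>x \<in> I \<rightarrow>\<^sub>E A. \<forall>y \<in> I \<rightarrow>\<^sub>E A. restrict x \<Omega>' = restrict y \<Omega>' \<longrightarrow>
        restrict (f x) \<Omega> = restrict (f y) \<Omega>"
      using uc[unfolded uniformly_continuous_wrt_prodiscrete[OF f], THEN spec, THEN mp, THEN mp,
          OF \<Omega>(1,2)]
      by (elim exE conjE) (rule that)
    have "f y \<in> U" if y: "y \<in> I \<rightarrow>\<^sub>E A" and "restrict x \<Omega>' = restrict y \<Omega>'" for y
      using \<Omega>(3)[THEN bspec, THEN mp, OF funcset_mem[OF f y]
          eq[THEN bspec, THEN bspec, THEN mp, OF x(1) that]] .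
    then show ?thesis
      by (intro exI[of _ \<Omega>'] conjI ballI impI \<Omega>')
  qed
  then show "openin (prodiscrete_topology I A)
      {x \<in> topspace (prodiscrete_topology I A). f x \<in> U}"
    unfolding openin_prodiscrete_topology by auto
qed

section \<open>Shifts, memory sets and local functions\<close>

text \<open>The inverse inside \<open>shift\<close> cancels the one applied to \<open>h\<close>,
  since \<open>\<phi>\<close> preserves inverses. So the local function at \<open>h\<close> reads
  \<open>x\<close> at the cells \<open>\<phi> h \<otimes> s\<close> with \<open>s\<close> in the
  memory set.\<close>

lemma shift_hom_inv:
  assumes "group G" "group H" "\<phi> \<in> hom H G" "h \<in> carrier H" "g \<in> carrier G"
  shows "shift G (\<phi> (inv\<^bsub>H\<^esub> h)) x g = x (\<phi> h \<otimes>\<^bsub>G\<^esub> g)"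
proof -
  interpret group_hom H G \<phi>
    using assms by (simp add: group_hom_def group_hom_axioms_def)
  show ?thesis using assms by (simp add: shift_def)
qed

lemma shift_in_PiE:
  assumes "group G" "g \<in> carrier G" "x \<in> carrier G \<rightarrow>\<^sub>E A"
  shows "shift G g x \<in> carrier G \<rightarrow>\<^sub>E A"
proof -
  interpret group G by fact
  show ?thesis using assms(2,3) by (auto simp: shift_def)
qed

lemma cellular_automaton_imp_uniformly_continuous:
  assumes G: "group G" and H: "group H" and \<phi>: "\<phi> \<in> hom H G"
    and ca: "cellular_automaton G H \<phi> A \<tau>"
  shows "uniformly_continuous_wrt
    (prodiscrete_uniformity (carrier G) A) (prodiscrete_uniformity (carrier H) A) \<tau>"
proof -
  interpret G: group G by fact
  obtain S \<mu> where \<tau>: "\<tau> \<in> (carrier G \<rightarrow>\<^sub>E A) \<rightarrow> (carrier H \<rightarrow>\<^sub>E A)"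
    and S: "finite S" "S \<subseteq> carrier G"
    and \<mu>: "\<forall>x \<in> carrier G \<rightarrow>\<^sub>E A. \<forall>h \<in> carrier H.
      \<tau> x h = \<mu> (restrict (shift G (\<phi> (inv\<^bsub>H\<^esub> h)) x) S)"
    using ca unfolding cellular_automaton_def by (elim conjE exE) (rule that)
  show ?thesis
    unfolding uniformly_continuous_wrt_prodiscrete[OF \<tau>]
  proof (intro allI impI exI conjI ballI)
    fix \<Omega> assume \<Omega>: "finite \<Omega>" "\<Omega> \<subseteq> carrier H"
    \<comment> \<open>These are exactly the cells read when computing the output on
      \<open>\<Omega>\<close>; the set is finite as an image of a product of finite sets.\<close>
    let ?\<Omega>' = "(\<lambda>(h, s). \<phi> h \<otimes>\<^bsub>G\<^esub> s) ` (\<Omega> \<times> S)"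
    show "finite ?\<Omega>'" using \<Omega> S by simp
    show "?\<Omega>' \<subseteq> carrier G" using \<Omega> S \<phi> by (auto dest: hom_in_carrier)
    fix x y assume x: "x \<in> carrier G \<rightarrow>\<^sub>E A" and y: "y \<in> carrier G \<rightarrow>\<^sub>E A"
      and eq: "restrict x ?\<Omega>' = restrict y ?\<Omega>'"
    have "\<tau> x h = \<tau> y h" if h: "h \<in> \<Omega>" for h
    proof -
      have hH: "h \<in> carrier H" using h \<Omega> by blast
      have "shift G (\<phi> (inv\<^bsub>H\<^esub> h)) x s = shift G (\<phi> (inv\<^bsub>H\<^esub> h)) y s" if s: "s \<in> S" for s
      proof -
        have mem: "\<phi> h \<otimes>\<^bsub>G\<^esub> s \<in> ?\<Omega>'" using h s by force
        have "x (\<phi> h \<otimes>\<^bsub>G\<^esub> s) = y (\<phi> h \<otimes>\<^bsub>G\<^esub> s)"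
          using fun_cong[OF eq, of "\<phi> h \<otimes>\<^bsub>G\<^esub> s"] by (simp only: restrict_apply'[OF mem])
        then show ?thesis
          using s S by (simp add: shift_hom_inv[OF G H \<phi> hH] subset_iff)
      qed
      then have "restrict (shift G (\<phi> (inv\<^bsub>H\<^esub> h)) x) S = restrict (shift G (\<phi> (inv\<^bsub>H\<^esub> h)) y) S"
        by (rule restrict_ext)
      then show ?thesis using \<mu>[rule_format, OF x hH] \<mu>[rule_format, OF y hH] by simp
    qed
    then show "restrict (\<tau> x) \<Omega> = restrict (\<tau> y) \<Omega>"
      by (rule restrict_ext)
  qed
qed

text \<open>The local function extends a pattern on \<open>S\<close> to a full configuration and
  takes the value of \<open>\<tau>\<close> at the identity; \<open>det\<close> makes that value
  independent of the extension. Equivariance carries the rule from the identity to every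
  \<open>h\<close>.\<close>

lemma equivariant_finitely_determined_imp_cellular_automaton:
  assumes G: "group G" and H: "group H" and \<phi>: "\<phi> \<in> hom H G"
    and \<tau>: "\<tau> \<in> (carrier G \<rightarrow>\<^sub>E A) \<rightarrow> (carrier H \<rightarrow>\<^sub>E A)"
    and equiv: "equivariant G H \<phi> A \<tau>"
    and a: "a \<in> A"
    and S: "finite S" "S \<subseteq> carrier G"
    and det: "\<And>x y. x \<in> carrier G \<rightarrow>\<^sub>E A \<Longrightarrow> y \<in> carrier G \<rightarrow>\<^sub>E A \<Longrightarrow>
      restrict x S = restrict y S \<Longrightarrow> \<tau> x \<one>\<^bsub>H\<^esub> = \<tau> y \<one>\<^bsub>H\<^esub>"
  shows "cellular_automaton G H \<phi> A \<tau>"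
proof -
  interpret H: group H by fact
  \<comment> \<open>The value \<open>a\<close> fills the cells outside \<open>S\<close>, so that the
    extended pattern is again a configuration over \<open>A\<close>.\<close>
  let ?ext = "\<lambda>u. \<lambda>g\<in>carrier G. if g \<in> S then u g else a"
  let ?\<mu> = "\<lambda>u. \<tau> (?ext u) \<one>\<^bsub>H\<^esub>"
  have ext: "?ext u \<in> carrier G \<rightarrow>\<^sub>E A" if "\<And>s. s \<in> S \<Longrightarrow> u s \<in> A" for u
    using that a by auto
  have \<mu>: "?\<mu> \<in> (S \<rightarrow>\<^sub>E A) \<rightarrow> A"
  proof
    fix u assume "u \<in> S \<rightarrow>\<^sub>E A"
    then have "\<tau> (?ext u) \<in> carrier H \<rightarrow>\<^sub>E A"
      using funcset_mem[OF \<tau> ext] by blast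
    then show "?\<mu> u \<in> A" using H.one_closed by (rule PiE_mem)
  qed
  have local: "\<tau> x h = ?\<mu> (restrict (shift G (\<phi> (inv\<^bsub>H\<^esub> h)) x) S)"
    if x: "x \<in> carrier G \<rightarrow>\<^sub>E A" and h: "h \<in> carrier H" for x h
  proof -
    let ?y = "shift G (\<phi> (inv\<^bsub>H\<^esub> h)) x"
    have y: "?y \<in> carrier G \<rightarrow>\<^sub>E A"
      using x h hom_in_carrier[OF \<phi>] by (intro shift_in_PiE G) auto
    \<comment> \<open>Shifting by the inverse of \<open>h\<close> moves the value at
      \<open>h\<close> to the identity, where \<open>det\<close> can be applied.\<close>
    have "\<tau> x h = shift H (inv\<^bsub>H\<^esub> h) (\<tau> x) \<one>\<^bsub>H\<^esub>"
      using h by (simp add: shift_def)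
    also have "\<dots> = \<tau> ?y \<one>\<^bsub>H\<^esub>"
      using equiv x h unfolding equivariant_def by simp
    also have "\<dots> = ?\<mu> (restrict ?y S)"
    \<comment> \<open>Restricting the shifted configuration to \<open>S\<close> and extending it by
      \<open>a\<close> changes it only outside \<open>S\<close>.\<close>
    proof (rule det[OF y])
      show "?ext (restrict ?y S) \<in> carrier G \<rightarrow>\<^sub>E A"
        using y S by (intro ext) auto
      show "restrict ?y S = restrict (?ext (restrict ?y S)) S"
        using S by (intro restrict_ext) auto
    qed
    finally show ?thesis .
  qed
  show ?thesis
    unfolding cellular_automaton_def
    by (intro conjI exI[of _ S] exI[of _ ?\<mu>] ballI \<tau> S \<mu> local)
qed

section \<open>From continuity at zero to finite dependence\<close>

text \<open>Two configurations agreeing on \<open>S\<close> differ by one that vanishes on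
  \<open>S\<close>. Additivity therefore reduces the comparison of arbitrary pairs to the behaviour
  of \<open>f\<close> near zero.\<close>

lemma additive_continuous_at_zero_finitely_determined:
  assumes V: "abelian_group V"
    and add: "\<And>x y. x \<in> I \<rightarrow>\<^sub>E carrier V \<Longrightarrow> y \<in> I \<rightarrow>\<^sub>E carrier V \<Longrightarrow>
      f (\<lambda>i\<in>I. x i \<oplus>\<^bsub>V\<^esub> y i) = (\<lambda>j\<in>J. f x j \<oplus>\<^bsub>V\<^esub> f y j)"
    and cont: "topcontinuous_at (prodiscrete_topology I (carrier V))
      (prodiscrete_topology J (carrier V)) f (\<lambda>i\<in>I. \<zero>\<^bsub>V\<^esub>)"
    and j: "j \<in> J"
  obtains S where "finite S" "S \<subseteq> I"
    "\<And>x y. x \<in> I \<rightarrow>\<^sub>E carrier V \<Longrightarrow> y \<in> I \<rightarrow>\<^sub>E carrier V \<Longrightarrow>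
      restrict x S = restrict y S \<Longrightarrow> f x j = f y j"
proof -
  interpret V: abelian_group V by fact
  let ?z = "\<lambda>i\<in>I. \<zero>\<^bsub>V\<^esub>"
  \<comment> \<open>Vanishing at the single coordinate \<open>j\<close> is an open condition, so
    this is the neighbourhood of zero on which continuity is tested.\<close>
  let ?U = "{v \<in> J \<rightarrow>\<^sub>E carrier V. v j = \<zero>\<^bsub>V\<^esub>}"
  have f: "f \<in> (I \<rightarrow>\<^sub>E carrier V) \<rightarrow> (J \<rightarrow>\<^sub>E carrier V)"
    using cont unfolding topcontinuous_at_def by auto
  have val: "f x j \<in> carrier V" if "x \<in> I \<rightarrow>\<^sub>E carrier V" for x
    using funcset_mem[OF f that] j by (rule PiE_mem)
  have z: "?z \<in> I \<rightarrow>\<^sub>E carrier V" by auto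
  have "(\<lambda>i\<in>I. ?z i \<oplus>\<^bsub>V\<^esub> ?z i) = ?z" by (auto simp: restrict_def)
  \<comment> \<open>Since zero plus zero is zero, the value of \<open>f\<close> at zero is
    idempotent under addition in coordinate \<open>j\<close>; cancellation makes it zero, which
    places \<open>f ?z\<close> in \<open>?U\<close>.\<close>
  then have "f ?z j = f ?z j \<oplus>\<^bsub>V\<^esub> f ?z j"
    using fun_cong[OF add[OF z z], of j] j by simp
  then have "f ?z j = \<zero>\<^bsub>V\<^esub>"
    using val[OF z] by (metis V.add.r_cancel_one')
  moreover have "openin (prodiscrete_topology J (carrier V)) ?U"
  proof -
    have "v j = \<zero>\<^bsub>V\<^esub>" if "restrict u {j} = restrict v {j}" "u j = \<zero>\<^bsub>V\<^esub>" for u v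
      using fun_cong[OF that(1), of j] that(2) by simp
    then show ?thesis
      unfolding openin_prodiscrete_topology using j
      by (intro conjI ballI exI[of _ "{j}"]) auto
  qed
  ultimately obtain W where W: "openin (prodiscrete_topology I (carrier V)) W" "?z \<in> W"
    "\<forall>x\<in>W. f x \<in> ?U"
    using cont funcset_mem[OF f z] unfolding topcontinuous_at_def by auto
  \<comment> \<open>The neighbourhood \<open>W\<close> of zero contains every configuration
    vanishing on a suitable finite \<open>S\<close>, and \<open>f\<close> of such a configuration
    vanishes at \<open>j\<close>.\<close>
  obtain S where S: "finite S" "S \<subseteq> I"
    and SW: "\<forall>x \<in> I \<rightarrow>\<^sub>E carrier V. restrict ?z S = restrict x S \<longrightarrow> x \<in> W"
    using W(1)[unfolded openin_prodiscrete_topology, THEN conjunct2, THEN bspec, OF W(2)]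
    by (elim exE conjE) (rule that)
  have det: "f x j = f y j"
    if x: "x \<in> I \<rightarrow>\<^sub>E carrier V" and y: "y \<in> I \<rightarrow>\<^sub>E carrier V"
      and eq: "restrict x S = restrict y S" for x y
  proof -
    let ?d = "\<lambda>i\<in>I. x i \<ominus>\<^bsub>V\<^esub> y i"
    have xV: "x i \<in> carrier V" and yV: "y i \<in> carrier V" if "i \<in> I" for i
      using x y that by (auto intro: PiE_mem)
    have d: "?d \<in> I \<rightarrow>\<^sub>E carrier V"
      using xV yV by auto
    have "restrict ?z S = restrict ?d S"
    proof (rule restrict_ext)
      fix s assume s: "s \<in> S"
      then have "x s = y s" using fun_cong[OF eq, of s] by simp
      then show "?z s = ?d s" using s S(2) yV by (auto simp: V.minus_eq V.r_neg)
    qed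
    then have "f ?d j = \<zero>\<^bsub>V\<^esub>" using W(3) SW[THEN bspec, THEN mp, OF d] by blast
    \<comment> \<open>Adding \<open>y\<close> back to the difference recovers \<open>x\<close>, so
      additivity gives \<open>f x j\<close> as zero plus \<open>f y j\<close>.\<close>
    moreover have "(\<lambda>i\<in>I. ?d i \<oplus>\<^bsub>V\<^esub> y i) = x"
      using x xV yV
      by (auto simp: fun_eq_iff V.minus_eq V.a_assoc V.l_neg PiE_iff extensional_def)
    then have "f x j = f ?d j \<oplus>\<^bsub>V\<^esub> f y j"
      using fun_cong[OF add[OF d y], of j] j by simp
    ultimately show ?thesis using val[OF y] by simp
  qed
  show thesis by (rule that[OF S det])
qed

theorem theorem23:
  fixes G :: "('g, 'm) monoid_scheme" and H :: "('h, 'n) monoid_scheme"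
    and \<phi> :: "'h \<Rightarrow> 'g"
    and K :: "('k, 'p) ring_scheme" and V :: "('k, 'v, 'q) module_scheme"
    and \<tau> :: "('g \<Rightarrow> 'v) \<Rightarrow> ('h \<Rightarrow> 'v)"
  assumes "group G" and "group H" and "\<phi> \<in> hom H G"
    and "vectorspace K V"
    and "\<tau> \<in> module_hom K (power_module (carrier G) V) (power_module (carrier H) V)"
    and "equivariant G H \<phi> (carrier V) \<tau>"
  shows "(linear_cellular_automaton G H \<phi> K V \<tau> \<longleftrightarrow>
      uniformly_continuous_wrt
        (prodiscrete_uniformity (carrier G) (carrier V))
        (prodiscrete_uniformity (carrier H) (carrier V)) \<tau>) \<and>
    (uniformly_continuous_wrt
        (prodiscrete_uniformity (carrier G) (carrier V))
        (prodiscrete_uniformity (carrier H) (carrier V)) \<tau> \<longleftrightarrow>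
      continuous_map
        (prodiscrete_topology (carrier G) (carrier V))
        (prodiscrete_topology (carrier H) (carrier V)) \<tau>) \<and>
    (continuous_map
        (prodiscrete_topology (carrier G) (carrier V))
        (prodiscrete_topology (carrier H) (carrier V)) \<tau> \<longleftrightarrow>
      topcontinuous_at
        (prodiscrete_topology (carrier G) (carrier V))
        (prodiscrete_topology (carrier H) (carrier V)) \<tau>
        (\<lambda>g\<in>carrier G. \<zero>\<^bsub>V\<^esub>))"
proof -
  interpret V: vectorspace K V by fact
  interpret H: group H by fact
  let ?XG = "prodiscrete_topology (carrier G) (carrier V)"
  let ?XH = "prodiscrete_topology (carrier H) (carrier V)"
  let ?UG = "prodiscrete_uniformity (carrier G) (carrier V)"
  let ?UH = "prodiscrete_uniformity (carrier H) (carrier V)"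
  let ?z = "\<lambda>g\<in>carrier G. \<zero>\<^bsub>V\<^esub>"
  have \<tau>: "\<tau> \<in> (carrier G \<rightarrow>\<^sub>E carrier V) \<rightarrow> (carrier H \<rightarrow>\<^sub>E carrier V)"
    using assms(5) by (simp add: module_hom_def)
  have add: "\<tau> (\<lambda>g\<in>carrier G. x g \<oplus>\<^bsub>V\<^esub> y g) = (\<lambda>h\<in>carrier H. \<tau> x h \<oplus>\<^bsub>V\<^esub> \<tau> y h)"
    if "x \<in> carrier G \<rightarrow>\<^sub>E carrier V" "y \<in> carrier G \<rightarrow>\<^sub>E carrier V" for x y
    using assms(5) that by (simp add: module_hom_def)
  \<comment> \<open>The three equivalences come from a cycle of implications: cellular automaton,
    uniformly continuous, continuous, continuous at zero, and back.\<close>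
  have ab: "uniformly_continuous_wrt ?UG ?UH \<tau>" if "linear_cellular_automaton G H \<phi> K V \<tau>"
    using that cellular_automaton_imp_uniformly_continuous[OF assms(1-3)]
    unfolding linear_cellular_automaton_def by blast
  have bc: "continuous_map ?XG ?XH \<tau>" if "uniformly_continuous_wrt ?UG ?UH \<tau>"
    using \<tau> that by (rule uniformly_continuous_imp_continuous_prodiscrete)
  have cd: "topcontinuous_at ?XG ?XH \<tau> ?z" if "continuous_map ?XG ?XH \<tau>"
    using that by (simp add: continuous_map_eq_topcontinuous_at)
  have da: "linear_cellular_automaton G H \<phi> K V \<tau>" if d: "topcontinuous_at ?XG ?XH \<tau> ?z"
  proof -
    \<comment> \<open>Finite dependence is taken at the coordinate \<open>\<one>\<close> of
      \<open>H\<close>, where equivariance can spread it to all of \<open>H\<close>; below, the zero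
      of \<open>V\<close> is the filling value for patterns.\<close>
    obtain S where "finite S" "S \<subseteq> carrier G"
      "\<And>x y. x \<in> carrier G \<rightarrow>\<^sub>E carrier V \<Longrightarrow> y \<in> carrier G \<rightarrow>\<^sub>E carrier V \<Longrightarrow>
        restrict x S = restrict y S \<Longrightarrow> \<tau> x \<one>\<^bsub>H\<^esub> = \<tau> y \<one>\<^bsub>H\<^esub>"
      using additive_continuous_at_zero_finitely_determined
        [OF V.abelian_group_axioms add d H.one_closed] by blast
    then have "cellular_automaton G H \<phi> (carrier V) \<tau>"
      by (rule equivariant_finitely_determined_imp_cellular_automaton
          [OF assms(1-3) \<tau> assms(6) V.M.zero_closed])
    then show ?thesis
      using assms(5) by (simp add: linear_cellular_automaton_def)
  qed
  from ab bc cd da show ?thesis by blast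
qed

end
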